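(* The six patterns of length $3$ fall into exactly three $\mathsf{iar}$-Wilf-equivalence classes, namely $$\{213,312,321\},\quad\{132,231\},\quad\{123\},$$ and into exactly three $\mathsf{comp}$-Wilf-equivalence classes, namely $$\{231,312,321\},\quad\{132,213\},\quad\{123\}.$$
   Context: $\mathfrak{S}_n$ is the set of permutations $\pi=\pi(1)\cdots\pi(n)$ of $[n]=\{1,\dots,n\}$. A permutation $\pi\in\mathfrak{S}_n$ contains the pattern $\sigma\in\mathfrak{S}_k$ if there are $j_1<\cdots<j_k$ such that $\pi(j_a)<\pi(j_b)$ if and only if $\sigma(a)<\sigma(b)$ for all $1\le a<b\le k$; otherwise it avoids $\sigma$. $\mathfrak{S}_n(\sigma)$ is the set of permutations in $\mathfrak{S}_n$ avoiding $\sigma$. For $\pi\in\mathfrak{S}_n$, $\mathsf{iar}(\pi)$ is the smallest $i\in[n-1]$ with $\pi(i)>\pi(i+1)$, or $n$ if there is no such $i$; and $\mathsf{comp}(\pi)=|\{i\in[n]:\pi(j)\le i\text{ for all }j\le i\}|$. For a statistic $\mathsf{st}$, patterns $\sigma$ and $\tau$ are $\mathsf{st}$-Wilf-equivalent if for all $n\ge1$ and every value $v$, the number of $\pi\in\mathfrak{S}_n(\sigma)$ with $\mathsf{st}(\pi)=v$ equals the number of $\pi\in\mathfrak{S}_n(\tau)$ with $\mathsf{st}(\pi)=v$. *)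

theory Defs
  imports Main "HOL-Combinatorics.Multiset_Permutations"
begin

text \<open>
  A permutation of \<open>{1..n}\<close> is its one-line word \<open>\<pi>(1) \<dots> \<pi>(n)\<close>, a list.
  List positions start at 0, hence the shift in \<open>entry\<close>.
\<close>

definition perms :: "nat \<Rightarrow> nat list set" where
  "perms n = permutations_of_set {1..n}"

definition entry :: "nat list \<Rightarrow> nat \<Rightarrow> nat" where
  "entry \<pi> i = \<pi> ! (i - 1)"

definition contains_pattern :: "nat list \<Rightarrow> nat list \<Rightarrow> bool" where
  "contains_pattern \<pi> \<sigma> \<longleftrightarrow>
     (\<exists>j :: nat \<Rightarrow> nat. strict_mono_on {1..length \<sigma>} j \<and> j ` {1..length \<sigma>} \<subseteq> {1..length \<pi>} \<and>
       (\<forall>a b. 1 \<le> a \<and> a < b \<and> b \<le> length \<sigma> \<longrightarrow>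
          (entry \<pi> (j a) < entry \<pi> (j b) \<longleftrightarrow> entry \<sigma> a < entry \<sigma> b)))"

definition avoiders :: "nat \<Rightarrow> nat list \<Rightarrow> nat list set" where
  "avoiders n \<sigma> = {\<pi> \<in> perms n. \<not> contains_pattern \<pi> \<sigma>}"

definition iar :: "nat list \<Rightarrow> nat" where
  "iar \<pi> =
     (if \<exists>i\<in>{1..length \<pi> - 1}. entry \<pi> i > entry \<pi> (i + 1)
      then LEAST i. i \<in> {1..length \<pi> - 1} \<and> entry \<pi> i > entry \<pi> (i + 1)
      else length \<pi>)"

definition comp_stat :: "nat list \<Rightarrow> nat" where
  "comp_stat \<pi> = card {i \<in> {1..length \<pi>}. \<forall>j\<in>{1..i}. entry \<pi> j \<le> i}"

definition st_Wilf_equivalent :: "(nat list \<Rightarrow> 'v) \<Rightarrow> nat list \<Rightarrow> nat list \<Rightarrow> bool" where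
  "st_Wilf_equivalent st \<sigma> \<tau> \<longleftrightarrow>
     (\<forall>n\<ge>1. \<forall>v. card {\<pi> \<in> avoiders n \<sigma>. st \<pi> = v} = card {\<pi> \<in> avoiders n \<tau>. st \<pi> = v})"

definition st_Wilf_rel :: "(nat list \<Rightarrow> 'v) \<Rightarrow> nat \<Rightarrow> (nat list \<times> nat list) set" where
  "st_Wilf_rel st k = {(\<sigma>, \<tau>). \<sigma> \<in> perms k \<and> \<tau> \<in> perms k \<and> st_Wilf_equivalent st \<sigma> \<tau>}"

lemma equiv_st_Wilf_rel: "equiv (perms k) (st_Wilf_rel st k)"
  by (rule equivI) (auto simp: st_Wilf_rel_def st_Wilf_equivalent_def refl_on_def sym_def trans_def)

end

theory Submission
  imports Defs
begin

text \<open>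
  Pattern classes are separated by a single observation. In size \<open>k\<close> a pattern of size \<open>k\<close> is avoided by every
  permutation but itself, so equivalent patterns have the same value of the statistic
  (\<open>st_Wilf_equivalent_imp_st_eq\<close>). The values of \<open>iar\<close> and of \<open>comp_stat\<close> on the six patterns already
  split them into the classes claimed, and it remains to prove the equivalences inside each class.

  No explicit bijection is built for the pairs 312, 321 and 132, 231. Instead each pair comes with an invariant
  whose fibres both avoidance classes meet exactly once; then every statistic that is a function of the
  invariant is equidistributed on the two classes (\<open>st_Wilf_equivalentI_fibres\<close>).
  For 312 and 321 the invariant consists of the prefix maxima, as in the bijection of Simion and Schmidt.
  Swapping the two smaller entries of an occurrence of one pattern turns it into an occurrence of the other
  and keeps the prefix maxima, so a permutation that minimises or maximises a weighted sum of its entries among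
  those with the same prefix maxima avoids 312 or 321, respectively; and the prefix maxima leave an avoider no choice
  (\<open>prefix_bounds_eq_cases\<close>). Both \<open>iar\<close> and \<open>comp_stat\<close> are functions of the prefix maxima.
  For 132 and 231 the invariant is the shape of the decreasing binary tree. Here the two smaller entries may be
  taken to be consecutive values, and swapping those keeps the shape (\<open>shape_swap\<close>). The shape determines the
  positions of all ascents and descents, hence \<open>iar\<close>, and also \<open>iar\<close> of the complement; the latter gives the
  equivalence of 312 and 213.

  The remaining equivalences for \<open>comp_stat\<close> are symmetries: inversion exchanges 231 and 312, the reverse
  complement exchanges 132 and 213, and both preserve the set of initial segments that are mapped to
  themselves, up to reflection.
\<close>

section \<open>Permutations as words\<close>

definition word :: "nat \<Rightarrow> (nat \<Rightarrow> nat) \<Rightarrow> nat list" where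
  "word n f = map f [1..<Suc n]"

lemma length_word [simp]: "length (word n f) = n"
  by (simp add: word_def)

lemma entry_word [simp]: "i \<in> {1..n} \<Longrightarrow> entry (word n f) i = f i"
  by (auto simp: word_def entry_def nth_append simp del: upt_Suc)

lemma entry_image: "entry \<pi> ` {1..length \<pi>} = set \<pi>"
proof -
  have "entry \<pi> ` {1..length \<pi>} = (!) \<pi> ` ((\<lambda>i. i - 1) ` {1..length \<pi>})"
    by (simp add: entry_def image_image)
  also have "(\<lambda>i. i - 1) ` {1..length \<pi>} = {0..<length \<pi>}"
    by (simp add: image_minus_const_atLeastLessThan_nat atLeastLessThanSuc_atLeastAtMost [symmetric])
  finally show ?thesis
    using nth_image[of "length \<pi>" \<pi>] by simp
qed

lemma perms_iff: "\<pi> \<in> perms n \<longleftrightarrow> length \<pi> = n \<and> bij_betw (entry \<pi>) {1..n} {1..n}"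
proof
  assume "\<pi> \<in> perms n"
  then have set: "set \<pi> = {1..n}" and "distinct \<pi>"
    by (auto simp: perms_def permutations_of_set_def)
  then have len: "length \<pi> = n" using distinct_card[of \<pi>] by simp
  moreover have "entry \<pi> ` {1..n} = {1..n}" using entry_image[of \<pi>] unfolding len set .
  ultimately show "length \<pi> = n \<and> bij_betw (entry \<pi>) {1..n} {1..n}"
    using eq_card_imp_inj_on[of "{1..n}" "entry \<pi>"] by (simp add: bij_betw_def)
next
  assume "length \<pi> = n \<and> bij_betw (entry \<pi>) {1..n} {1..n}"
  then have "length \<pi> = n" "set \<pi> = {1..n}"
    using entry_image[of \<pi>] by (auto simp: bij_betw_def)
  then show "\<pi> \<in> perms n"
    using card_distinct[of \<pi>] by (simp add: perms_def permutations_of_set_def)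
qed

lemma word_in_perms: "bij_betw f {1..n} {1..n} \<Longrightarrow> word n f \<in> perms n"
  unfolding perms_iff length_word by (subst bij_betw_cong[where g = f]) auto

lemma bij_betw_entry: "\<pi> \<in> perms n \<Longrightarrow> bij_betw (entry \<pi>) {1..n} {1..n}"
  by (simp only: perms_iff)

lemma length_perms: "\<pi> \<in> perms n \<Longrightarrow> length \<pi> = n"
  by (simp add: perms_iff)

lemma finite_perms: "finite (perms n)"
  by (simp add: perms_def)

lemma
  assumes "\<pi> \<in> perms n"
  shows entry_image_perms: "entry \<pi> ` {1..n} = {1..n}"
    and inj_on_entry: "inj_on (entry \<pi>) {1..n}"
  using assms by (simp_all only: perms_iff bij_betw_def)

lemma entry_mem: "\<pi> \<in> perms n \<Longrightarrow> i \<in> {1..n} \<Longrightarrow> entry \<pi> i \<in> {1..n}"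
  using imageI[of i "{1..n}" "entry \<pi>"] by (simp only: entry_image_perms)

lemma entry_eq_iff:
  "\<pi> \<in> perms n \<Longrightarrow> i \<in> {1..n} \<Longrightarrow> j \<in> {1..n} \<Longrightarrow> entry \<pi> i = entry \<pi> j \<longleftrightarrow> i = j"
  using inj_on_entry by (rule inj_on_eq_iff)

lemma entry_surj:
  assumes "\<pi> \<in> perms n" "v \<in> {1..n}"
  obtains i where "i \<in> {1..n}" "entry \<pi> i = v"
proof -
  have "v \<in> entry \<pi> ` {1..n}" using assms by (simp only: entry_image_perms)
  then show thesis using that by (elim imageE) simp
qed

lemma perms_eqI:
  assumes "\<pi> \<in> perms n" "\<rho> \<in> perms n" "\<And>i. i \<in> {1..n} \<Longrightarrow> entry \<pi> i = entry \<rho> i"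
  shows "\<pi> = \<rho>"
proof (rule nth_equalityI)
  show "length \<pi> = length \<rho>" using assms by (simp add: perms_iff)
  fix i assume "i < length \<pi>"
  then show "\<pi> ! i = \<rho> ! i"
    using assms(3)[of "Suc i"] assms(1) by (simp add: perms_iff entry_def)
qed

text \<open>
  An entry is its own rank among all entries, and ranks only depend on comparisons of entries.
\<close>

lemma perms_eqI_order:
  assumes \<pi>: "\<pi> \<in> perms n" and \<rho>: "\<rho> \<in> perms n"
    and le: "\<And>x y. x \<in> {1..n} \<Longrightarrow> y \<in> {1..n} \<Longrightarrow> x < y \<Longrightarrow>
      entry \<pi> x < entry \<pi> y \<longleftrightarrow> entry \<rho> x < entry \<rho> y"
  shows "\<pi> = \<rho>"
proof (rule perms_eqI[OF \<pi> \<rho>])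
  fix x assume x: "x \<in> {1..n}"
  have rank: "entry \<tau> x = card {y \<in> {1..n}. entry \<tau> y \<le> entry \<tau> x}" if \<tau>: "\<tau> \<in> perms n" for \<tau>
  proof -
    have "entry \<tau> ` {y \<in> {1..n}. entry \<tau> y \<le> entry \<tau> x} = {1..entry \<tau> x}"
    proof (intro equalityI subsetI)
      fix v assume "v \<in> {1..entry \<tau> x}"
      moreover from this obtain i where "i \<in> {1..n}" "entry \<tau> i = v"
        using entry_surj[OF \<tau>, of v] entry_mem[OF \<tau> x] by auto
      ultimately show "v \<in> entry \<tau> ` {y \<in> {1..n}. entry \<tau> y \<le> entry \<tau> x}" by auto
    qed (use entry_mem[OF \<tau>] in auto)
    moreover have "inj_on (entry \<tau>) {y \<in> {1..n}. entry \<tau> y \<le> entry \<tau> x}"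
      using inj_on_entry[OF \<tau>] by (rule inj_on_subset) auto
    ultimately show ?thesis using card_image by force
  qed
  have "entry \<pi> y \<le> entry \<pi> x \<longleftrightarrow> entry \<rho> y \<le> entry \<rho> x" if y: "y \<in> {1..n}" for y
    using le[OF x y] le[OF y x] entry_eq_iff[OF \<pi> x y] entry_eq_iff[OF \<rho> x y]
    by (cases x y rule: linorder_cases) auto
  then have "{y \<in> {1..n}. entry \<pi> y \<le> entry \<pi> x} = {y \<in> {1..n}. entry \<rho> y \<le> entry \<rho> x}" by auto
  then show "entry \<pi> x = entry \<rho> x" using rank[OF \<pi>] rank[OF \<rho>] by simp
qed

section \<open>Patterns of length three\<close>

lemma contains_pattern_three:
  "contains_pattern \<pi> [x, y, z] \<longleftrightarrow> (\<exists>i j k. 1 \<le> i \<and> i < j \<and> j < k \<and> k \<le> length \<pi> \<and>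
     (entry \<pi> i < entry \<pi> j \<longleftrightarrow> x < y) \<and> (entry \<pi> i < entry \<pi> k \<longleftrightarrow> x < z) \<and>
     (entry \<pi> j < entry \<pi> k \<longleftrightarrow> y < z))" (is "?L \<longleftrightarrow> ?R")
proof
  have e: "entry [x, y, z] 1 = x" "entry [x, y, z] 2 = y" "entry [x, y, z] 3 = z"
    by (simp_all add: entry_def)
  show ?R if ?L
  proof -
    from that obtain f where f: "strict_mono_on {1..3::nat} f" "f ` {1..3} \<subseteq> {1..length \<pi>}"
      and c: "\<And>a b. 1 \<le> a \<Longrightarrow> a < b \<Longrightarrow> b \<le> 3 \<Longrightarrow>
        entry \<pi> (f a) < entry \<pi> (f b) \<longleftrightarrow> entry [x, y, z] a < entry [x, y, z] b"
      unfolding contains_pattern_def by (auto simp: eval_nat_numeral)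
    have "f 1 < f 2" "f 2 < f 3" using f(1) by (auto simp: strict_mono_on_def)
    moreover have "f 1 \<ge> 1" "f 3 \<le> length \<pi>"
      using subsetD[OF f(2) imageI, of 1] subsetD[OF f(2) imageI, of 3] by auto
    ultimately show ?R using c[of 1 2] c[of 1 3] c[of 2 3] unfolding e by auto
  qed
  show ?L if ?R
  proof -
    from that obtain i j k where p: "1 \<le> i" "i < j" "j < k" "k \<le> length \<pi>"
      and c: "entry \<pi> i < entry \<pi> j \<longleftrightarrow> x < y" "entry \<pi> i < entry \<pi> k \<longleftrightarrow> x < z"
        "entry \<pi> j < entry \<pi> k \<longleftrightarrow> y < z" by blast
    define f where "f a = (if a = 1 then i else if a = 2 then j else k)" for a :: nat
    have "entry \<pi> (f a) < entry \<pi> (f b) \<longleftrightarrow> entry [x, y, z] a < entry [x, y, z] b"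
      if "1 \<le> a" "a < b" "b \<le> 3" for a b
    proof -
      from that consider "a = 1" "b = 2" | "a = 1" "b = 3" | "a = 2" "b = 3" by linarith
      then show ?thesis by cases (simp_all only: e, simp_all add: f_def c)
    qed
    moreover have "strict_mono_on {1..3} f" using p by (auto simp: strict_mono_on_def f_def)
    moreover have "f ` {1..3} \<subseteq> {1..length \<pi>}" using p by (auto simp: f_def)
    ultimately show ?L unfolding contains_pattern_def by (intro exI[of _ f]) (auto simp: eval_nat_numeral)
  qed
qed

lemma contains_iff:
  assumes \<pi>: "\<pi> \<in> perms n"
  shows contains_132: "contains_pattern \<pi> [1,3,2] \<longleftrightarrow> (\<exists>i j k. 1 \<le> i \<and> i < j \<and> j < k \<and> k \<le> n \<and>
      entry \<pi> i < entry \<pi> k \<and> entry \<pi> k < entry \<pi> j)"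
    and contains_213: "contains_pattern \<pi> [2,1,3] \<longleftrightarrow> (\<exists>i j k. 1 \<le> i \<and> i < j \<and> j < k \<and> k \<le> n \<and>
      entry \<pi> j < entry \<pi> i \<and> entry \<pi> i < entry \<pi> k)"
    and contains_231: "contains_pattern \<pi> [2,3,1] \<longleftrightarrow> (\<exists>i j k. 1 \<le> i \<and> i < j \<and> j < k \<and> k \<le> n \<and>
      entry \<pi> k < entry \<pi> i \<and> entry \<pi> i < entry \<pi> j)"
    and contains_312: "contains_pattern \<pi> [3,1,2] \<longleftrightarrow> (\<exists>i j k. 1 \<le> i \<and> i < j \<and> j < k \<and> k \<le> n \<and>
      entry \<pi> j < entry \<pi> k \<and> entry \<pi> k < entry \<pi> i)"
    and contains_321: "contains_pattern \<pi> [3,2,1] \<longleftrightarrow> (\<exists>i j k. 1 \<le> i \<and> i < j \<and> j < k \<and> k \<le> n \<and>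
      entry \<pi> k < entry \<pi> j \<and> entry \<pi> j < entry \<pi> i)"
proof -
  have ne: "\<not> entry \<pi> i < entry \<pi> j \<longleftrightarrow> entry \<pi> j < entry \<pi> i" if "1 \<le> i" "i < j" "j \<le> n" for i j
    using entry_eq_iff[OF \<pi>, of i j] that by auto
  note three = contains_pattern_three length_perms[OF \<pi>]
  show "contains_pattern \<pi> [1,3,2] \<longleftrightarrow> (\<exists>i j k. 1 \<le> i \<and> i < j \<and> j < k \<and> k \<le> n \<and>
      entry \<pi> i < entry \<pi> k \<and> entry \<pi> k < entry \<pi> j)"
    unfolding three by (intro ex_cong1) (use ne in force)
  show "contains_pattern \<pi> [2,1,3] \<longleftrightarrow> (\<exists>i j k. 1 \<le> i \<and> i < j \<and> j < k \<and> k \<le> n \<and>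
      entry \<pi> j < entry \<pi> i \<and> entry \<pi> i < entry \<pi> k)"
    unfolding three by (intro ex_cong1) (use ne in force)
  show "contains_pattern \<pi> [2,3,1] \<longleftrightarrow> (\<exists>i j k. 1 \<le> i \<and> i < j \<and> j < k \<and> k \<le> n \<and>
      entry \<pi> k < entry \<pi> i \<and> entry \<pi> i < entry \<pi> j)"
    unfolding three by (intro ex_cong1) (use ne in force)
  show "contains_pattern \<pi> [3,1,2] \<longleftrightarrow> (\<exists>i j k. 1 \<le> i \<and> i < j \<and> j < k \<and> k \<le> n \<and>
      entry \<pi> j < entry \<pi> k \<and> entry \<pi> k < entry \<pi> i)"
    unfolding three by (intro ex_cong1) (use ne in force)
  show "contains_pattern \<pi> [3,2,1] \<longleftrightarrow> (\<exists>i j k. 1 \<le> i \<and> i < j \<and> j < k \<and> k \<le> n \<and>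
      entry \<pi> k < entry \<pi> j \<and> entry \<pi> j < entry \<pi> i)"
    unfolding three by (intro ex_cong1) (use ne in force)
qed

section \<open>Swapping two entries\<close>

definition swap :: "nat \<Rightarrow> nat \<Rightarrow> nat list \<Rightarrow> nat list" where
  "swap i k \<pi> = word (length \<pi>) (entry \<pi> \<circ> transpose i k)"

lemma swap_in_perms:
  assumes "\<pi> \<in> perms n" "i \<in> {1..n}" "k \<in> {1..n}"
  shows "swap i k \<pi> \<in> perms n"
proof -
  have "bij_betw (transpose i k) {1..n} {1..n}"
    using assms(2,3) by (intro permutes_imp_bij permutes_swap_id)
  then show ?thesis
    unfolding swap_def length_perms[OF assms(1)]
    by (rule word_in_perms[OF bij_betw_trans[OF _ bij_betw_entry[OF assms(1)]]])
qed

lemma entry_swap: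
  assumes "\<pi> \<in> perms n" "l \<in> {1..n}"
  shows "entry (swap i k \<pi>) l = (if l = i then entry \<pi> k else if l = k then entry \<pi> i else entry \<pi> l)"
  using assms by (simp add: swap_def length_perms transpose_def)

text \<open>
  Any strictly monotone measure of sortedness would do. This one is convenient since a swap changes only two of
  its terms; as in the rearrangement inequality, putting the larger of two entries first decreases it.
\<close>

definition weight :: "nat list \<Rightarrow> int" where
  "weight \<pi> = (\<Sum>i\<in>{1..length \<pi>}. int i * int (entry \<pi> i))"

lemma weight_swap:
  assumes \<pi>: "\<pi> \<in> perms n" and ik: "i \<in> {1..n}" "k \<in> {1..n}" "i < k"
  shows "weight \<pi> - weight (swap i k \<pi>) = (int k - int i) * (int (entry \<pi> k) - int (entry \<pi> i))"
proof -
  have split: "sum g {1..n} = g i + g k + sum g ({1..n} - {i, k})" for g :: "nat \<Rightarrow> int"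
  proof -
    have "sum g {1..n} = sum g ({1..n} - {i, k}) + sum g {i, k}"
      using ik by (intro sum.subset_diff) auto
    then show ?thesis using ik by simp
  qed
  have "sum (\<lambda>l. int l * int (entry (swap i k \<pi>) l)) ({1..n} - {i, k}) =
        sum (\<lambda>l. int l * int (entry \<pi> l)) ({1..n} - {i, k})"
    by (intro sum.cong) (auto simp: entry_swap[OF \<pi>])
  then show ?thesis
    using ik unfolding weight_def length_perms[OF \<pi>] length_perms[OF swap_in_perms[OF \<pi> ik(1,2)]]
      split[of "\<lambda>l. int l * int (entry _ l)"]
    by (simp add: entry_swap[OF \<pi>] algebra_simps)
qed

lemma weight_swap_less:
  assumes "\<pi> \<in> perms n" "i \<in> {1..n}" "k \<in> {1..n}" "i < k" "entry \<pi> i < entry \<pi> k"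
  shows "weight (swap i k \<pi>) < weight \<pi>"
proof -
  have "0 < (int k - int i) * (int (entry \<pi> k) - int (entry \<pi> i))"
    using assms by (intro mult_pos_pos) simp_all
  then show ?thesis using weight_swap[OF assms(1-4)] by linarith
qed

lemma weight_swap_greater:
  assumes "\<pi> \<in> perms n" "i \<in> {1..n}" "k \<in> {1..n}" "i < k" "entry \<pi> k < entry \<pi> i"
  shows "weight \<pi> < weight (swap i k \<pi>)"
proof -
  have "(int k - int i) * (int (entry \<pi> k) - int (entry \<pi> i)) < 0"
    using assms by (intro mult_pos_neg) simp_all
  then show ?thesis using weight_swap[OF assms(1-4)] by linarith
qed

section \<open>Avoidance classes as transversals\<close>

text \<open>
  An element of smallest weight in its fibre of \<open>f\<close> admits no further move, so it lies in \<open>A\<close>.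
\<close>

lemma fibre_representative:
  fixes w :: "'a \<Rightarrow> int"
  assumes "finite S" "x \<in> S"
    and move: "\<And>y. y \<in> S \<Longrightarrow> y \<notin> A \<Longrightarrow> \<exists>z\<in>S. f z = f y \<and> w z < w y"
  shows "\<exists>y\<in>A. f y = f x"
proof -
  let ?F = "{y \<in> S. f y = f x}"
  have F: "finite ?F" "?F \<noteq> {}" using assms by auto
  define y where "y = arg_min_on w ?F"
  have y: "y \<in> ?F" "\<not> (\<exists>z\<in>?F. w z < w y)"
    unfolding y_def using arg_min_if_finite[OF F, of w] by auto
  then have "y \<in> A" using move[of y] by auto
  with y show ?thesis by auto
qed

text \<open>
  Here \<open>A\<close> meets every fibre of \<open>f\<close> exactly once. The right-hand side does not mention \<open>A\<close>, so any two
  such transversals carry the same distribution of a statistic that factors through \<open>f\<close>.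
\<close>

lemma card_fibre:
  assumes "A \<subseteq> S" "inj_on f A" "\<And>x. x \<in> S \<Longrightarrow> \<exists>y\<in>A. f y = f x"
    and st: "\<And>x y. x \<in> S \<Longrightarrow> y \<in> S \<Longrightarrow> f x = f y \<Longrightarrow> st x = st y"
  shows "card {x \<in> A. st x = v} = card (f ` {x \<in> S. st x = v})"
proof -
  have "f ` {x \<in> S. st x = v} = f ` {x \<in> A. st x = v}"
  proof (intro equalityI subsetI)
    fix u assume "u \<in> f ` {x \<in> S. st x = v}"
    then obtain x where x: "x \<in> S" "st x = v" "u = f x" by auto
    then obtain y where "y \<in> A" "f y = f x" using assms(3) by blast
    with x have "y \<in> {x \<in> A. st x = v}" using st[of y x] assms(1) by blast
    with x \<open>f y = f x\<close> show "u \<in> f ` {x \<in> A. st x = v}" by (metis imageI)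
  qed (use assms(1) in auto)
  moreover have "inj_on f {x \<in> A. st x = v}" using assms(2) by (auto simp: inj_on_def)
  ultimately show ?thesis by (simp add: card_image)
qed

text \<open>
  The engine behind both non-symmetric equivalences. An occurrence of \<open>\<sigma>\<close> can be undone by a move that
  keeps \<open>f\<close> and lowers the weight, an occurrence of \<open>\<tau>\<close> by one that keeps \<open>f\<close> and raises it; hence each
  fibre of \<open>f\<close> contains avoiders of both patterns, and by injectivity exactly one of each.
\<close>

lemma st_Wilf_equivalentI_fibres:
  assumes inj: "\<And>n. inj_on f (avoiders n \<sigma>)" "\<And>n. inj_on f (avoiders n \<tau>)"
    and down: "\<And>n \<pi>. \<pi> \<in> perms n \<Longrightarrow> contains_pattern \<pi> \<sigma> \<Longrightarrow>
      \<exists>\<rho>\<in>perms n. f \<rho> = f \<pi> \<and> weight \<rho> < weight \<pi>"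
    and up: "\<And>n \<pi>. \<pi> \<in> perms n \<Longrightarrow> contains_pattern \<pi> \<tau> \<Longrightarrow>
      \<exists>\<rho>\<in>perms n. f \<rho> = f \<pi> \<and> weight \<pi> < weight \<rho>"
    and st: "\<And>n \<pi> \<rho>. \<pi> \<in> perms n \<Longrightarrow> \<rho> \<in> perms n \<Longrightarrow> f \<pi> = f \<rho> \<Longrightarrow> st \<pi> = st \<rho>"
  shows "st_Wilf_equivalent st \<sigma> \<tau>"
  unfolding st_Wilf_equivalent_def
proof (intro allI impI)
  fix n :: nat and v
  have sub: "avoiders n \<sigma> \<subseteq> perms n" "avoiders n \<tau> \<subseteq> perms n" by (auto simp: avoiders_def)
  have "\<exists>\<rho>\<in>avoiders n \<sigma>. f \<rho> = f \<pi>" if "\<pi> \<in> perms n" for \<pi>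
    using down by (intro fibre_representative[OF finite_perms that, where w = weight])
      (auto simp: avoiders_def)
  then have "card {\<pi> \<in> avoiders n \<sigma>. st \<pi> = v} = card (f ` {\<pi> \<in> perms n. st \<pi> = v})"
    by (intro card_fibre[OF sub(1) inj(1)] st)
  moreover
  have "\<exists>\<rho>\<in>avoiders n \<tau>. f \<rho> = f \<pi>" if "\<pi> \<in> perms n" for \<pi>
    using up by (intro fibre_representative[OF finite_perms that, where w = "\<lambda>\<pi>. - weight \<pi>"])
      (auto simp: avoiders_def)
  then have "card {\<pi> \<in> avoiders n \<tau>. st \<pi> = v} = card (f ` {\<pi> \<in> perms n. st \<pi> = v})"
    by (intro card_fibre[OF sub(2) inj(2)] st)
  ultimately show "card {\<pi> \<in> avoiders n \<sigma>. st \<pi> = v} = card {\<pi> \<in> avoiders n \<tau>. st \<pi> = v}"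
    by simp
qed

section \<open>The patterns 312 and 321\<close>

text \<open>
  The upper bounds of each initial segment. This is the sequence of prefix maxima in a form that avoids
  \<open>Max\<close>: it encodes the positions and the values of the left-to-right maxima.
\<close>

definition prefix_bounds :: "nat list \<Rightarrow> (nat \<times> nat) set" where
  "prefix_bounds \<pi> = {(m, v). m \<in> {1..length \<pi>} \<and> (\<forall>l\<in>{1..m}. entry \<pi> l \<le> v)}"

text \<open>
  Two entries that stand to the right of a larger one are not left-to-right maxima, and they stay below that
  larger entry when they trade places.
\<close>

lemma prefix_bounds_swap:
  assumes \<pi>: "\<pi> \<in> perms n" and p: "1 \<le> i" "i < j" "j < k" "k \<le> n"
    and less: "entry \<pi> j < entry \<pi> i" "entry \<pi> k < entry \<pi> i"
  shows "prefix_bounds (swap j k \<pi>) = prefix_bounds \<pi>"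
proof -
  have "(\<forall>l\<in>{1..m}. entry (swap j k \<pi>) l \<le> v) \<longleftrightarrow> (\<forall>l\<in>{1..m}. entry \<pi> l \<le> v)"
    if m: "m \<le> n" for m v
  proof (cases "j \<le> m")
    case True
    have i: "i \<in> {1..m}" "entry (swap j k \<pi>) i = entry \<pi> i"
      using p True m by (auto simp: entry_swap[OF \<pi>])
    show ?thesis
    proof (cases "entry \<pi> i \<le> v")
      case True
      then show ?thesis using less m by (intro ball_cong) (auto simp: entry_swap[OF \<pi>])
    next
      case False
      then show ?thesis using i by metis
    qed
  next
    case False
    then show ?thesis using p m by (intro ball_cong) (auto simp: entry_swap[OF \<pi>])
  qed
  moreover have "length (swap j k \<pi>) = length \<pi>" by (simp add: swap_def)
  ultimately show ?thesis using length_perms[OF \<pi>] by (auto simp: prefix_bounds_def)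
qed

text \<open>
  Read \<open>\<pi>\<close> and \<open>\<rho>\<close> up to the first position \<open>j\<close> where they differ, say with \<open>\<pi>(j) < \<rho>(j)\<close>. Equal prefix maxima
  force a common earlier entry \<open>M > \<rho>(j)\<close>. The value \<open>\<rho>(j)\<close> occurs in \<open>\<pi>\<close> only after \<open>j\<close>, which gives the 312
  \<open>M \<pi>(j) \<rho>(j)\<close> in \<open>\<pi>\<close>; the value \<open>\<pi>(j)\<close> occurs in \<open>\<rho>\<close> only after \<open>j\<close>, which gives the 321 \<open>M \<rho>(j) \<pi>(j)\<close>
  in \<open>\<rho>\<close>. So neither two 312-avoiders nor two 321-avoiders share their prefix maxima.
\<close>

lemma prefix_bounds_eq_cases:
  assumes \<pi>: "\<pi> \<in> perms n" and \<rho>: "\<rho> \<in> perms n"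
    and eq: "prefix_bounds \<pi> = prefix_bounds \<rho>" and ne: "\<pi> \<noteq> \<rho>"
  shows "contains_pattern \<pi> [3,1,2] \<and> contains_pattern \<rho> [3,2,1] \<or>
         contains_pattern \<rho> [3,1,2] \<and> contains_pattern \<pi> [3,2,1]"
proof -
  have main: "contains_pattern \<pi> [3,1,2] \<and> contains_pattern \<rho> [3,2,1]"
    if \<pi>: "\<pi> \<in> perms n" and \<rho>: "\<rho> \<in> perms n" and eq: "prefix_bounds \<pi> = prefix_bounds \<rho>"
      and j: "j \<in> {1..n}" and same: "\<And>l. 1 \<le> l \<Longrightarrow> l < j \<Longrightarrow> entry \<pi> l = entry \<rho> l"
      and less: "entry \<pi> j < entry \<rho> j" for \<pi> \<rho> j
  proof -
    let ?a = "entry \<pi> j" and ?b = "entry \<rho> j"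
    \<comment> \<open>otherwise \<open>?b - 1\<close> would bound the first \<open>j\<close> entries of \<open>\<pi>\<close> but not those of \<open>\<rho>\<close>\<close>
    have "\<exists>i\<in>{1..<j}. ?b \<le> entry \<pi> i"
    proof (rule ccontr)
      assume "\<not> ?thesis"
      then have "entry \<pi> l \<le> ?b - 1" if "l \<in> {1..j}" for l
        using less that by (cases "l = j") force+
      then have "(j, ?b - 1) \<in> prefix_bounds \<pi>"
        using j \<pi> by (auto simp: prefix_bounds_def length_perms)
      then have "\<forall>l\<in>{1..j}. entry \<rho> l \<le> ?b - 1" unfolding eq by (simp add: prefix_bounds_def)
      then have "?b \<le> ?b - 1" using j by simp
      then show False using less by simp
    qed
    then obtain i where i: "1 \<le> i" "i < j" "?b \<le> entry \<pi> i" by auto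
    moreover have "?b \<noteq> entry \<rho> i" using i j entry_eq_iff[OF \<rho>, of j i] by auto
    ultimately have big: "?b < entry \<pi> i" "?b < entry \<rho> i" using same by auto
    have later: "j < l" if "l \<in> {1..n}" "entry \<tau> l = entry \<tau>' j" "entry \<tau> j \<noteq> entry \<tau>' j"
      "\<And>l. 1 \<le> l \<Longrightarrow> l < j \<Longrightarrow> entry \<tau> l = entry \<tau>' l" "\<tau>' \<in> perms n" for l \<tau> \<tau>'
      using that entry_eq_iff[OF that(5), of l j] j by (cases l j rule: linorder_cases) auto
    obtain k where k: "k \<in> {1..n}" "entry \<pi> k = ?b" using entry_surj[OF \<pi> entry_mem[OF \<rho> j]] .
    obtain k' where k': "k' \<in> {1..n}" "entry \<rho> k' = ?a" using entry_surj[OF \<rho> entry_mem[OF \<pi> j]] .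
    have "j < k" using later[OF k] same less \<rho> by simp
    have "j < k'" using later[OF k'] same less \<pi> by simp
    have "contains_pattern \<pi> [3,1,2]"
      unfolding contains_312[OF \<pi>] using i big less k \<open>j < k\<close>
      by - (rule exI[of _ i], rule exI[of _ j], rule exI[of _ k], simp)
    moreover have "contains_pattern \<rho> [3,2,1]"
      unfolding contains_321[OF \<rho>] using i big less k' \<open>j < k'\<close>
      by - (rule exI[of _ i], rule exI[of _ j], rule exI[of _ k'], simp)
    ultimately show ?thesis ..
  qed
  let ?D = "\<lambda>j. j \<in> {1..n} \<and> entry \<pi> j \<noteq> entry \<rho> j"
  define j where "j = (LEAST j. ?D j)"
  have "\<exists>j. ?D j" using perms_eqI[OF \<pi> \<rho>] ne by blast
  then have j: "?D j" unfolding j_def by (rule LeastI_ex)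
  have same: "entry \<pi> l = entry \<rho> l" if "1 \<le> l" "l < j" for l
    using not_less_Least[of l ?D] that j unfolding j_def[symmetric] by auto
  show ?thesis
    using main[OF \<pi> \<rho> eq, of j] main[OF \<rho> \<pi> eq[symmetric], of j] j same
    by (cases "entry \<pi> j" "entry \<rho> j" rule: linorder_cases) auto
qed

lemma st_Wilf_equivalent_312_321:
  assumes "\<And>n \<pi> \<rho>. \<pi> \<in> perms n \<Longrightarrow> \<rho> \<in> perms n \<Longrightarrow> prefix_bounds \<pi> = prefix_bounds \<rho> \<Longrightarrow>
    st \<pi> = st \<rho>"
  shows "st_Wilf_equivalent st [3,1,2] [3,2,1]"
proof (rule st_Wilf_equivalentI_fibres[where f = prefix_bounds])
  show "inj_on prefix_bounds (avoiders n [3,1,2])" "inj_on prefix_bounds (avoiders n [3,2,1])" for n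
    by (auto intro!: inj_onI simp only: avoiders_def mem_Collect_eq dest: prefix_bounds_eq_cases)
next
  fix n \<pi> assume \<pi>: "\<pi> \<in> perms n" and "contains_pattern \<pi> [3,1,2]"
  then obtain i j k where p: "1 \<le> i" "i < j" "j < k" "k \<le> n"
    "entry \<pi> j < entry \<pi> k" "entry \<pi> k < entry \<pi> i" unfolding contains_312[OF \<pi>] by blast
  have "weight (swap j k \<pi>) < weight \<pi>" using p by (intro weight_swap_less[OF \<pi>]) auto
  then show "\<exists>\<rho>\<in>perms n. prefix_bounds \<rho> = prefix_bounds \<pi> \<and> weight \<rho> < weight \<pi>"
    using p by (intro bexI[of _ "swap j k \<pi>"] conjI prefix_bounds_swap[OF \<pi> p(1-4)] swap_in_perms[OF \<pi>]) auto
next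
  fix n \<pi> assume \<pi>: "\<pi> \<in> perms n" and "contains_pattern \<pi> [3,2,1]"
  then obtain i j k where p: "1 \<le> i" "i < j" "j < k" "k \<le> n"
    "entry \<pi> k < entry \<pi> j" "entry \<pi> j < entry \<pi> i" unfolding contains_321[OF \<pi>] by blast
  have "weight \<pi> < weight (swap j k \<pi>)" using p by (intro weight_swap_greater[OF \<pi>]) auto
  then show "\<exists>\<rho>\<in>perms n. prefix_bounds \<rho> = prefix_bounds \<pi> \<and> weight \<pi> < weight \<rho>"
    using p by (intro bexI[of _ "swap j k \<pi>"] conjI prefix_bounds_swap[OF \<pi> p(1-4)] swap_in_perms[OF \<pi>]) auto
qed (use assms in blast)

section \<open>The patterns 132 and 231\<close>

text \<open>
  The ancestor relation, on positions, of the decreasing binary tree of the word (root at the maximum, the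
  entries to its left and right forming the two subtrees): \<open>x\<close> is an ancestor of \<open>y\<close> when the entry at \<open>x\<close> is
  the largest one between the two positions.
\<close>

definition shape :: "nat list \<Rightarrow> (nat \<times> nat) set" where
  "shape \<pi> = {(x, y). x \<in> {1..length \<pi>} \<and> y \<in> {1..length \<pi>} \<and>
     (\<forall>l\<in>{min x y..max x y}. entry \<pi> l \<le> entry \<pi> x)}"

text \<open>
  Exchanging consecutive values affects no comparison except the one between these two entries. That
  comparison cannot matter to an ancestor relation, because every window containing both positions also
  contains the larger entry at \<open>j\<close>.
\<close>

lemma shape_swap:
  assumes \<pi>: "\<pi> \<in> perms n" and p: "1 \<le> i" "i < j" "j < k" "k \<le> n"
    and less: "entry \<pi> i < entry \<pi> j" "entry \<pi> k < entry \<pi> j"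
    and adjacent: "entry \<pi> k = Suc (entry \<pi> i) \<or> entry \<pi> i = Suc (entry \<pi> k)"
  shows "shape (swap i k \<pi>) = shape \<pi>"
proof -
  let ?s = "entry (swap i k \<pi>)"
  note entry_swap' = entry_swap[OF \<pi>, of _ i k]
  have keep: "?s l \<le> ?s x \<longleftrightarrow> entry \<pi> l \<le> entry \<pi> x"
    if "l \<in> {1..n}" "x \<in> {1..n}" "{l, x} \<noteq> {i, k}" for l x
  proof (cases "l = x")
    case False
    have ne: "entry \<pi> u \<noteq> entry \<pi> i \<and> entry \<pi> u \<noteq> entry \<pi> k" if "u \<in> {1..n}" "u \<noteq> i" "u \<noteq> k" for u
      using that p entry_eq_iff[OF \<pi>, of u i] entry_eq_iff[OF \<pi>, of u k] by simp
    from False that(3) consider "l \<in> {i, k}" "x \<noteq> i" "x \<noteq> k" | "l \<noteq> i" "l \<noteq> k" by blast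
    then show ?thesis
    proof cases
      case 1
      then show ?thesis
        using ne[OF that(2) 1(2,3)] adjacent p(2,3) by (auto simp: entry_swap'[OF that(1)] entry_swap'[OF that(2)])
    next
      case 2
      then show ?thesis
        using ne[OF that(1) 2] adjacent p(2,3) by (auto simp: entry_swap'[OF that(1)] entry_swap'[OF that(2)])
    qed
  qed simp
  have "(\<forall>l\<in>{min x y..max x y}. ?s l \<le> ?s x) \<longleftrightarrow> (\<forall>l\<in>{min x y..max x y}. entry \<pi> l \<le> entry \<pi> x)"
    if xy: "x \<in> {1..n}" "y \<in> {1..n}" for x y
  proof (cases "\<exists>l\<in>{min x y..max x y}. {l, x} = {i, k}")
    case True
    then have "j \<in> {min x y..max x y}" "x = i \<or> x = k"
      using p by (auto simp: doubleton_eq_iff min_def max_def split: if_splits)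
    moreover have "\<not> entry \<pi> j \<le> entry \<pi> x" "\<not> ?s j \<le> ?s x"
      using calculation(2) less p by (auto simp: entry_swap')
    ultimately show ?thesis by blast
  next
    case False
    then show ?thesis using xy by (intro ball_cong keep) (auto simp: min_def max_def split: if_splits)
  qed
  moreover have "length (swap i k \<pi>) = length \<pi>" by (simp add: swap_def)
  ultimately show ?thesis using length_perms[OF \<pi>] by (auto simp: shape_def)
qed

lemma exists_last_step:
  fixes a b :: nat
  assumes "a < b" "Q a" "\<not> Q b"
  shows "\<exists>v. a \<le> v \<and> v < b \<and> Q v \<and> \<not> Q (Suc v)"
  using assms
proof (induction b)
  case (Suc b)
  then show ?case by (cases "a = b \<or> Q b") (auto intro: exI[of _ b] less_SucI)
qed simp

text \<open>
  Consecutive values are what \<open>shape_swap\<close> needs. In an occurrence \<open>a c b\<close> of 132 the value \<open>a\<close> lies to the left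
  of \<open>c\<close> and \<open>b\<close> to its right, so somewhere between \<open>a\<close> and \<open>b\<close> there are values \<open>v\<close> and \<open>v + 1\<close> on
  different sides of \<open>c\<close>.
\<close>

lemma adjacent_132:
  assumes \<pi>: "\<pi> \<in> perms n" and "contains_pattern \<pi> [1,3,2]"
  shows "\<exists>i j k. 1 \<le> i \<and> i < j \<and> j < k \<and> k \<le> n \<and>
    entry \<pi> k = Suc (entry \<pi> i) \<and> entry \<pi> k < entry \<pi> j"
proof -
  from assms obtain i j k where p: "1 \<le> i" "i < j" "j < k" "k \<le> n"
    and less: "entry \<pi> i < entry \<pi> k" "entry \<pi> k < entry \<pi> j" unfolding contains_132[OF \<pi>] by blast
  let ?left = "\<lambda>v. \<exists>x\<in>{1..<j}. entry \<pi> x = v"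
  have "\<not> ?left (entry \<pi> k)" using p entry_eq_iff[OF \<pi>, of _ k] by force
  moreover have "?left (entry \<pi> i)" using p by (intro bexI[of _ i]) auto
  ultimately obtain v where v: "entry \<pi> i \<le> v" "v < entry \<pi> k" "?left v" "\<not> ?left (Suc v)"
    using exists_last_step[OF less(1), of ?left] by blast
  then obtain i' where i': "i' \<in> {1..<j}" "entry \<pi> i' = v" by blast
  obtain k' where k': "k' \<in> {1..n}" "entry \<pi> k' = Suc v"
    using entry_surj[OF \<pi>, of "Suc v"] entry_mem[OF \<pi>, of k] v p by auto
  have "k' \<noteq> j" using k' v less by auto
  then have "j < k'" using v(4) k' by (cases k' j rule: linorder_cases) auto
  then show ?thesis using i' k' v less
    by - (rule exI[of _ i'], rule exI[of _ j], rule exI[of _ k'], auto)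
qed

lemma adjacent_231:
  assumes \<pi>: "\<pi> \<in> perms n" and "contains_pattern \<pi> [2,3,1]"
  shows "\<exists>i j k. 1 \<le> i \<and> i < j \<and> j < k \<and> k \<le> n \<and>
    entry \<pi> i = Suc (entry \<pi> k) \<and> entry \<pi> i < entry \<pi> j"
proof -
  from assms obtain i j k where p: "1 \<le> i" "i < j" "j < k" "k \<le> n"
    and less: "entry \<pi> k < entry \<pi> i" "entry \<pi> i < entry \<pi> j" unfolding contains_231[OF \<pi>] by blast
  let ?right = "\<lambda>v. \<exists>x\<in>{j<..n}. entry \<pi> x = v"
  have "\<not> ?right (entry \<pi> i)" using p entry_eq_iff[OF \<pi>, of _ i] by force
  moreover have "?right (entry \<pi> k)" using p by (intro bexI[of _ k]) auto
  ultimately obtain v where v: "entry \<pi> k \<le> v" "v < entry \<pi> i" "?right v" "\<not> ?right (Suc v)"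
    using exists_last_step[OF less(1), of ?right] by blast
  then obtain k' where k': "k' \<in> {j<..n}" "entry \<pi> k' = v" by blast
  obtain i' where i': "i' \<in> {1..n}" "entry \<pi> i' = Suc v"
    using entry_surj[OF \<pi>, of "Suc v"] entry_mem[OF \<pi>, of i] v p by auto
  have "i' \<noteq> j" using i' v less by auto
  then have "i' < j" using v(4) i' by (cases i' j rule: linorder_cases) auto
  then show ?thesis using i' k' v less
    by - (rule exI[of _ i'], rule exI[of _ j], rule exI[of _ k'], auto)
qed

text \<open>
  If neither of two positions is an ancestor of the other, a larger entry stands between them, and avoiding
  132 forces the pair to be a descent. Thus the shape determines all comparisons of entries, hence the word.
\<close>

lemma ascent_iff_shape_132:
  assumes \<pi>: "\<pi> \<in> avoiders n [1,3,2]" and xy: "x \<in> {1..n}" "y \<in> {1..n}" "x < y"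
  shows "entry \<pi> x < entry \<pi> y \<longleftrightarrow> (y, x) \<in> shape \<pi>"
proof -
  have \<pi>': "\<pi> \<in> perms n" and av: "\<not> contains_pattern \<pi> [1,3,2]" using \<pi> by (auto simp: avoiders_def)
  show ?thesis
  proof
    assume less: "entry \<pi> x < entry \<pi> y"
    have "entry \<pi> l \<le> entry \<pi> y" if l: "x \<le> l" "l \<le> y" for l
    proof (rule ccontr)
      assume "\<not> ?thesis"
      moreover from this less have "l \<noteq> x" "l \<noteq> y" by auto
      ultimately have "contains_pattern \<pi> [1,3,2]"
        unfolding contains_132[OF \<pi>'] using l less xy
        by - (rule exI[of _ x], rule exI[of _ l], rule exI[of _ y], auto)
      with av show False ..
    qed
    then show "(y, x) \<in> shape \<pi>" using xy length_perms[OF \<pi>'] by (auto simp: shape_def)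
  next
    assume "(y, x) \<in> shape \<pi>"
    then have "entry \<pi> x \<le> entry \<pi> y" using xy by (auto simp: shape_def)
    then show "entry \<pi> x < entry \<pi> y" using entry_eq_iff[OF \<pi>' xy(1,2)] xy(3) by auto
  qed
qed

text \<open>
  The dual situation: a larger entry in between now forces an ascent.
\<close>

lemma ascent_iff_not_shape_231:
  assumes \<pi>: "\<pi> \<in> avoiders n [2,3,1]" and xy: "x \<in> {1..n}" "y \<in> {1..n}" "x < y"
  shows "entry \<pi> x < entry \<pi> y \<longleftrightarrow> (x, y) \<notin> shape \<pi>"
proof -
  have \<pi>': "\<pi> \<in> perms n" and av: "\<not> contains_pattern \<pi> [2,3,1]" using \<pi> by (auto simp: avoiders_def)
  have "(x, y) \<in> shape \<pi>" if less: "entry \<pi> y < entry \<pi> x"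
  proof -
    have "entry \<pi> l \<le> entry \<pi> x" if l: "x \<le> l" "l \<le> y" for l
    proof (rule ccontr)
      assume "\<not> ?thesis"
      moreover from this less have "l \<noteq> x" "l \<noteq> y" by auto
      ultimately have "contains_pattern \<pi> [2,3,1]"
        unfolding contains_231[OF \<pi>'] using l less xy
        by - (rule exI[of _ x], rule exI[of _ l], rule exI[of _ y], auto)
      with av show False ..
    qed
    then show ?thesis using xy length_perms[OF \<pi>'] by (auto simp: shape_def)
  qed
  moreover have "entry \<pi> y \<le> entry \<pi> x" if "(x, y) \<in> shape \<pi>"
    using that xy by (auto simp: shape_def)
  ultimately show ?thesis using entry_eq_iff[OF \<pi>' xy(1,2)] xy(3) by force
qed

lemma st_Wilf_equivalent_132_231:
  assumes "\<And>n \<pi> \<rho>. \<pi> \<in> perms n \<Longrightarrow> \<rho> \<in> perms n \<Longrightarrow> shape \<pi> = shape \<rho> \<Longrightarrow> st \<pi> = st \<rho>"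
  shows "st_Wilf_equivalent st [1,3,2] [2,3,1]"
proof (rule st_Wilf_equivalentI_fibres[where f = shape])
  show "inj_on shape (avoiders n [1,3,2])" for n
  proof (rule inj_onI)
    fix \<pi> \<rho> assume av: "\<pi> \<in> avoiders n [1,3,2]" "\<rho> \<in> avoiders n [1,3,2]" and "shape \<pi> = shape \<rho>"
    then show "\<pi> = \<rho>"
      using ascent_iff_shape_132[OF av(1)] ascent_iff_shape_132[OF av(2)]
      by (intro perms_eqI_order[of _ n]) (auto simp: avoiders_def)
  qed
  show "inj_on shape (avoiders n [2,3,1])" for n
  proof (rule inj_onI)
    fix \<pi> \<rho> assume av: "\<pi> \<in> avoiders n [2,3,1]" "\<rho> \<in> avoiders n [2,3,1]" and "shape \<pi> = shape \<rho>"
    then show "\<pi> = \<rho>"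
      using ascent_iff_not_shape_231[OF av(1)] ascent_iff_not_shape_231[OF av(2)]
      by (intro perms_eqI_order[of _ n]) (auto simp: avoiders_def)
  qed
next
  fix n \<pi> assume \<pi>: "\<pi> \<in> perms n" and "contains_pattern \<pi> [1,3,2]"
  then obtain i j k where p: "1 \<le> i" "i < j" "j < k" "k \<le> n"
    and e: "entry \<pi> k = Suc (entry \<pi> i)" "entry \<pi> k < entry \<pi> j" using adjacent_132 by blast
  have "weight (swap i k \<pi>) < weight \<pi>" using p e by (intro weight_swap_less[OF \<pi>]) auto
  then show "\<exists>\<rho>\<in>perms n. shape \<rho> = shape \<pi> \<and> weight \<rho> < weight \<pi>"
    using p e by (intro bexI[of _ "swap i k \<pi>"] conjI shape_swap[OF \<pi> p] swap_in_perms[OF \<pi>]) auto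
next
  fix n \<pi> assume \<pi>: "\<pi> \<in> perms n" and "contains_pattern \<pi> [2,3,1]"
  then obtain i j k where p: "1 \<le> i" "i < j" "j < k" "k \<le> n"
    and e: "entry \<pi> i = Suc (entry \<pi> k)" "entry \<pi> i < entry \<pi> j" using adjacent_231 by blast
  have "weight \<pi> < weight (swap i k \<pi>)" using p e by (intro weight_swap_greater[OF \<pi>]) auto
  then show "\<exists>\<rho>\<in>perms n. shape \<rho> = shape \<pi> \<and> weight \<pi> < weight \<rho>"
    using p e by (intro bexI[of _ "swap i k \<pi>"] conjI shape_swap[OF \<pi> p] swap_in_perms[OF \<pi>]) auto
qed (use assms in blast)

section \<open>The statistics as functions of the invariants\<close>

text \<open>
  Bounding \<open>iar\<close> from below by conditions on ascents replaces its definition by a least element, which makes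
  it easy to compare across words.
\<close>

lemma le_iar_iff:
  assumes m: "m \<in> {1..length \<pi>}" and \<pi>: "\<pi> \<in> perms n"
  shows "m \<le> iar \<pi> \<longleftrightarrow> (\<forall>i\<in>{1..<m}. entry \<pi> i < entry \<pi> (Suc i))"
proof -
  let ?D = "\<lambda>i. i \<in> {1..length \<pi> - 1} \<and> entry \<pi> i > entry \<pi> (i + 1)"
  have asc: "entry \<pi> i < entry \<pi> (Suc i) \<longleftrightarrow> \<not> ?D i" if "i \<in> {1..<m}" for i
    using that m entry_eq_iff[OF \<pi>, of i "Suc i"] length_perms[OF \<pi>] by auto
  show ?thesis
  proof (cases "\<exists>i. ?D i")
    case True
    then have iar: "iar \<pi> = (LEAST i. ?D i)" unfolding iar_def by auto
    have "?D (iar \<pi>)" unfolding iar using True by (rule LeastI_ex)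
    moreover have "\<not> ?D i" if "i < iar \<pi>" for i using not_less_Least[of i ?D] that iar by simp
    ultimately show ?thesis using asc by force
  next
    case False
    then have "iar \<pi> = length \<pi>" unfolding iar_def by auto
    then show ?thesis using m asc False by auto
  qed
qed

lemma iar_eqI:
  assumes \<pi>: "\<pi> \<in> perms n" and \<rho>: "\<rho> \<in> perms n"
    and eq: "\<And>m. m \<in> {1..n} \<Longrightarrow> (\<forall>i\<in>{1..<m}. entry \<pi> i < entry \<pi> (Suc i)) \<longleftrightarrow>
      (\<forall>i\<in>{1..<m}. entry \<rho> i < entry \<rho> (Suc i))"
  shows "iar \<pi> = iar \<rho>"
proof -
  have range: "iar \<tau> \<le> n \<and> (iar \<tau> = 0 \<longleftrightarrow> n = 0)" if "\<tau> \<in> perms n" for \<tau>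
  proof (cases "\<exists>i. i \<in> {1..length \<tau> - 1} \<and> entry \<tau> i > entry \<tau> (i + 1)")
    case True
    then have "iar \<tau> \<in> {1..length \<tau> - 1}"
      using LeastI_ex[OF True] unfolding iar_def by auto
    then show ?thesis using length_perms[OF that] by auto
  next
    case False
    then have "iar \<tau> = length \<tau>" unfolding iar_def by auto
    then show ?thesis using length_perms[OF that] by auto
  qed
  have "m \<le> iar \<pi> \<longleftrightarrow> m \<le> iar \<rho>" if "m \<in> {1..n}" for m
    using le_iar_iff[OF _ \<pi>, of m] le_iar_iff[OF _ \<rho>, of m] eq[OF that] that
    by (simp add: length_perms[OF \<pi>] length_perms[OF \<rho>])
  from this[of "iar \<pi>"] this[of "iar \<rho>"] show ?thesis
    using range[OF \<pi>] range[OF \<rho>] by (cases "n = 0") auto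
qed

text \<open>
  The first \<open>m\<close> entries increase exactly if each of them is a new prefix maximum, that is, if the set of upper
  bounds shrinks at each step.
\<close>

lemma iar_prefix_bounds:
  assumes \<pi>: "\<pi> \<in> perms n" and \<rho>: "\<rho> \<in> perms n" and eq: "prefix_bounds \<pi> = prefix_bounds \<rho>"
  shows "iar \<pi> = iar \<rho>"
proof -
  have inc: "(\<forall>i\<in>{1..<m}. entry \<tau> i < entry \<tau> (Suc i)) \<longleftrightarrow>
      (\<forall>i\<in>{1..<m}. \<exists>v. (i, v) \<in> prefix_bounds \<tau> \<and> (Suc i, v) \<notin> prefix_bounds \<tau>)"
    if \<tau>: "\<tau> \<in> perms n" and m: "m \<in> {1..n}" for \<tau> m
  proof (intro iffI ballI)
    fix i assume inc: "\<forall>i\<in>{1..<m}. entry \<tau> i < entry \<tau> (Suc i)" and i: "i \<in> {1..<m}"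
    have "entry \<tau> l \<le> entry \<tau> i" if "l \<in> {1..i}" for l
    proof -
      from that have "l \<le> i" "1 \<le> l" by auto
      then show ?thesis using i
      proof (induction rule: dec_induct)
        case (step a)
        then show ?case using inc[rule_format, of a] by auto
      qed simp
    qed
    then have "(i, entry \<tau> i) \<in> prefix_bounds \<tau>"
      using i m length_perms[OF \<tau>] by (auto simp: prefix_bounds_def)
    moreover have "(Suc i, entry \<tau> i) \<notin> prefix_bounds \<tau>"
      using inc i by (auto simp: prefix_bounds_def not_le intro!: bexI[of _ "Suc i"])
    ultimately show "\<exists>v. (i, v) \<in> prefix_bounds \<tau> \<and> (Suc i, v) \<notin> prefix_bounds \<tau>" by blast
  next
    fix i assume rec: "\<forall>i\<in>{1..<m}. \<exists>v. (i, v) \<in> prefix_bounds \<tau> \<and> (Suc i, v) \<notin> prefix_bounds \<tau>"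
      and i: "i \<in> {1..<m}"
    then obtain v where v: "(i, v) \<in> prefix_bounds \<tau>" "(Suc i, v) \<notin> prefix_bounds \<tau>" by blast
    have "\<exists>l\<in>{1..Suc i}. v < entry \<tau> l"
      using v(2) i m length_perms[OF \<tau>] by (auto simp: prefix_bounds_def not_le)
    moreover have "\<forall>l\<in>{1..i}. entry \<tau> l \<le> v" using v(1) by (simp add: prefix_bounds_def)
    ultimately have "v < entry \<tau> (Suc i)" by (force simp: atLeastAtMostSuc_conv)
    moreover have "entry \<tau> i \<le> v" using v i by (auto simp: prefix_bounds_def)
    ultimately show "entry \<tau> i < entry \<tau> (Suc i)" by simp
  qed
  show ?thesis by (rule iar_eqI[OF \<pi> \<rho>]) (simp only: inc[OF \<pi>] inc[OF \<rho>] eq)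
qed

lemma iar_312_321: "st_Wilf_equivalent iar [3,1,2] [3,2,1]"
  by (rule st_Wilf_equivalent_312_321) (rule iar_prefix_bounds)

lemma comp_stat_prefix_bounds: "comp_stat \<pi> = card {i. (i, i) \<in> prefix_bounds \<pi>}"
  by (simp add: comp_stat_def prefix_bounds_def)

lemma comp_312_321: "st_Wilf_equivalent comp_stat [3,1,2] [3,2,1]"
  by (rule st_Wilf_equivalent_312_321) (simp add: comp_stat_prefix_bounds)

lemma descent_shape:
  assumes \<pi>: "\<pi> \<in> perms n" and i: "i \<in> {1..<n}"
  shows "entry \<pi> (Suc i) < entry \<pi> i \<longleftrightarrow> (i, Suc i) \<in> shape \<pi>"
proof -
  have "{min i (Suc i)..max i (Suc i)} = {i, Suc i}" by auto
  then show ?thesis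
    using i length_perms[OF \<pi>] entry_eq_iff[OF \<pi>, of "Suc i" i] by (auto simp: shape_def)
qed

lemma ascent_shape:
  assumes \<pi>: "\<pi> \<in> perms n" and i: "i \<in> {1..<n}"
  shows "entry \<pi> i < entry \<pi> (Suc i) \<longleftrightarrow> (i, Suc i) \<notin> shape \<pi>"
  using descent_shape[OF assms] entry_eq_iff[OF \<pi>, of "Suc i" i] i by auto

lemma iar_shape:
  assumes \<pi>: "\<pi> \<in> perms n" and \<rho>: "\<rho> \<in> perms n" and eq: "shape \<pi> = shape \<rho>"
  shows "iar \<pi> = iar \<rho>"
  by (rule iar_eqI[OF \<pi> \<rho>]) (auto simp: ascent_shape[OF \<pi>] ascent_shape[OF \<rho>] eq)

lemma iar_132_231: "st_Wilf_equivalent iar [1,3,2] [2,3,1]"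
  by (rule st_Wilf_equivalent_132_231) (rule iar_shape)

section \<open>Symmetries of words\<close>

text \<open>
  The statistic \<open>st \<circ> h\<close> on the left allows for symmetries, such as complementation, that do not preserve
  \<open>st\<close>.
\<close>

lemma card_avoiders_involution:
  assumes h: "\<And>\<pi>. \<pi> \<in> perms n \<Longrightarrow> h \<pi> \<in> perms n" "\<And>\<pi>. \<pi> \<in> perms n \<Longrightarrow> h (h \<pi>) = \<pi>"
    and pat: "\<And>\<pi>. \<pi> \<in> perms n \<Longrightarrow> contains_pattern (h \<pi>) \<tau> \<longleftrightarrow> contains_pattern \<pi> \<sigma>"
  shows "card {\<pi> \<in> avoiders n \<sigma>. st (h \<pi>) = v} = card {\<pi> \<in> avoiders n \<tau>. st \<pi> = v}"
proof -
  have "bij_betw h {\<pi> \<in> avoiders n \<sigma>. st (h \<pi>) = v} {\<pi> \<in> avoiders n \<tau>. st \<pi> = v}"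
  proof (rule bij_betw_byWitness[where f' = h])
    show "h ` {\<pi> \<in> avoiders n \<tau>. st \<pi> = v} \<subseteq> {\<pi> \<in> avoiders n \<sigma>. st (h \<pi>) = v}"
      using h pat[OF h(1)] by (auto simp: avoiders_def)
  qed (use h pat in \<open>auto simp: avoiders_def\<close>)
  then show ?thesis by (rule bij_betw_same_card)
qed

lemma st_Wilf_equivalentI_involution:
  assumes h: "\<And>n \<pi>. \<pi> \<in> perms n \<Longrightarrow> h \<pi> \<in> perms n" "\<And>n \<pi>. \<pi> \<in> perms n \<Longrightarrow> h (h \<pi>) = \<pi>"
    and pat: "\<And>n \<pi>. \<pi> \<in> perms n \<Longrightarrow> contains_pattern \<pi> \<sigma> \<Longrightarrow> contains_pattern (h \<pi>) \<tau>"
      "\<And>n \<pi>. \<pi> \<in> perms n \<Longrightarrow> contains_pattern \<pi> \<tau> \<Longrightarrow> contains_pattern (h \<pi>) \<sigma>"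
    and st: "\<And>n \<pi>. \<pi> \<in> perms n \<Longrightarrow> st (h \<pi>) = st \<pi>"
  shows "st_Wilf_equivalent st \<sigma> \<tau>"
  unfolding st_Wilf_equivalent_def
proof (intro allI impI)
  fix n :: nat and v
  have "contains_pattern (h \<pi>) \<tau> \<longleftrightarrow> contains_pattern \<pi> \<sigma>" if "\<pi> \<in> perms n" for \<pi>
    using pat(1)[OF that] pat(2)[OF h(1)[OF that]] h(2)[OF that] by auto
  then have "card {\<pi> \<in> avoiders n \<sigma>. st (h \<pi>) = v} = card {\<pi> \<in> avoiders n \<tau>. st \<pi> = v}"
    using h by (intro card_avoiders_involution)
  moreover have "{\<pi> \<in> avoiders n \<sigma>. st (h \<pi>) = v} = {\<pi> \<in> avoiders n \<sigma>. st \<pi> = v}"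
    using st by (auto simp: avoiders_def)
  ultimately show "card {\<pi> \<in> avoiders n \<sigma>. st \<pi> = v} = card {\<pi> \<in> avoiders n \<tau>. st \<pi> = v}" by simp
qed

definition complement :: "nat list \<Rightarrow> nat list" where
  "complement \<pi> = word (length \<pi>) (\<lambda>i. Suc (length \<pi>) - entry \<pi> i)"

lemma bij_betw_reflect: "bij_betw (\<lambda>i. Suc n - i) {1..n} {1..n}"
  by (rule bij_betw_byWitness[where f' = "\<lambda>i. Suc n - i"]) auto

lemma complement_in_perms:
  assumes \<pi>: "\<pi> \<in> perms n"
  shows "complement \<pi> \<in> perms n"
  unfolding complement_def length_perms[OF \<pi>]
  by (rule word_in_perms)
    (rule bij_betw_trans[OF bij_betw_entry[OF \<pi>] bij_betw_reflect, unfolded comp_def])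

lemma entry_complement:
  "\<pi> \<in> perms n \<Longrightarrow> i \<in> {1..n} \<Longrightarrow> entry (complement \<pi>) i = Suc n - entry \<pi> i"
  by (simp add: complement_def length_perms)

lemma complement_complement:
  assumes \<pi>: "\<pi> \<in> perms n"
  shows "complement (complement \<pi>) = \<pi>"
proof (rule perms_eqI)
  fix i assume i: "i \<in> {1..n}"
  then show "entry (complement (complement \<pi>)) i = entry \<pi> i"
    using entry_mem[OF \<pi> i]
    by (simp add: entry_complement[OF \<pi>] entry_complement[OF complement_in_perms[OF \<pi>]])
qed (use \<pi> complement_in_perms in auto)

lemma entry_complement_less_iff:
  assumes "\<pi> \<in> perms n" "i \<in> {1..n}" "j \<in> {1..n}"
  shows "entry (complement \<pi>) i < entry (complement \<pi>) j \<longleftrightarrow> entry \<pi> j < entry \<pi> i"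
  using entry_mem[OF assms(1,2)] entry_mem[OF assms(1,3)] assms by (auto simp: entry_complement)

lemma contains_complement:
  assumes \<pi>: "\<pi> \<in> perms n"
  shows "contains_pattern (complement \<pi>) [3,1,2] \<longleftrightarrow> contains_pattern \<pi> [1,3,2]"
    and "contains_pattern (complement \<pi>) [2,1,3] \<longleftrightarrow> contains_pattern \<pi> [2,3,1]"
  unfolding contains_iff[OF \<pi>] contains_iff[OF complement_in_perms[OF \<pi>]]
  by (intro ex_cong1; auto simp: entry_complement_less_iff[OF \<pi>])+

text \<open>
  Complementation exchanges ascents and descents, and the shape records both.
\<close>

lemma iar_complement_shape:
  assumes \<pi>: "\<pi> \<in> perms n" and \<rho>: "\<rho> \<in> perms n" and eq: "shape \<pi> = shape \<rho>"
  shows "iar (complement \<pi>) = iar (complement \<rho>)"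
  using complement_in_perms[OF \<pi>] complement_in_perms[OF \<rho>]
  by (rule iar_eqI) (auto simp: entry_complement_less_iff[OF \<pi>] entry_complement_less_iff[OF \<rho>]
      descent_shape[OF \<pi>] descent_shape[OF \<rho>] eq)

text \<open>
  Complementation takes 132 to 312 and 231 to 213, so the shape argument for 132 and 231 is applied to the
  statistic \<open>iar \<circ> complement\<close>.
\<close>

lemma iar_312_213: "st_Wilf_equivalent iar [3,1,2] [2,1,3]"
proof -
  have "st_Wilf_equivalent (\<lambda>\<pi>. iar (complement \<pi>)) [1,3,2] [2,3,1]"
    by (rule st_Wilf_equivalent_132_231) (rule iar_complement_shape)
  moreover have "card {\<pi> \<in> avoiders n [1,3,2]. iar (complement \<pi>) = v} =
      card {\<pi> \<in> avoiders n [3,1,2]. iar \<pi> = v}" for n v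
    by (intro card_avoiders_involution complement_in_perms complement_complement contains_complement)
  moreover have "card {\<pi> \<in> avoiders n [2,3,1]. iar (complement \<pi>) = v} =
      card {\<pi> \<in> avoiders n [2,1,3]. iar \<pi> = v}" for n v
    by (intro card_avoiders_involution complement_in_perms complement_complement contains_complement)
  ultimately show ?thesis unfolding st_Wilf_equivalent_def by simp
qed

definition reverse_complement :: "nat list \<Rightarrow> nat list" where
  "reverse_complement \<pi> = word (length \<pi>) (\<lambda>i. Suc (length \<pi>) - entry \<pi> (Suc (length \<pi>) - i))"

lemma reverse_complement_in_perms:
  assumes \<pi>: "\<pi> \<in> perms n"
  shows "reverse_complement \<pi> \<in> perms n"
  unfolding reverse_complement_def length_perms[OF \<pi>]
  by (rule word_in_perms)
    (rule bij_betw_trans[OF bij_betw_trans[OF bij_betw_reflect bij_betw_entry[OF \<pi>]]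
        bij_betw_reflect, unfolded comp_def])

lemma entry_reverse_complement:
  "\<pi> \<in> perms n \<Longrightarrow> i \<in> {1..n} \<Longrightarrow> entry (reverse_complement \<pi>) i = Suc n - entry \<pi> (Suc n - i)"
  by (simp add: reverse_complement_def length_perms)

lemma entry_add_reverse_complement:
  assumes \<pi>: "\<pi> \<in> perms n" and l: "l \<in> {1..n}"
  shows "entry (reverse_complement \<pi>) (Suc n - l) + entry \<pi> l = Suc n"
proof -
  have "Suc n - l \<in> {1..n}" "Suc n - (Suc n - l) = l" using l by auto
  then show ?thesis using entry_reverse_complement[OF \<pi>, of "Suc n - l"] entry_mem[OF \<pi> l] by simp
qed

lemma reverse_complement_reverse_complement:
  assumes \<pi>: "\<pi> \<in> perms n"
  shows "reverse_complement (reverse_complement \<pi>) = \<pi>"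
proof (rule perms_eqI)
  fix i assume i: "i \<in> {1..n}"
  then have "Suc n - i \<in> {1..n}" "Suc n - (Suc n - i) = i" by auto
  then show "entry (reverse_complement (reverse_complement \<pi>)) i = entry \<pi> i"
    using i entry_mem[OF \<pi> i]
    by (simp add: entry_reverse_complement[OF \<pi>]
        entry_reverse_complement[OF reverse_complement_in_perms[OF \<pi>]])
qed (use \<pi> reverse_complement_in_perms in auto)

lemma contains_213_reverse_complement:
  assumes \<pi>: "\<pi> \<in> perms n" and c: "contains_pattern \<pi> [1,3,2]"
  shows "contains_pattern (reverse_complement \<pi>) [2,1,3]"
proof -
  from c obtain i j k where p: "1 \<le> i" "i < j" "j < k" "k \<le> n"
    "entry \<pi> i < entry \<pi> k" "entry \<pi> k < entry \<pi> j" unfolding contains_132[OF \<pi>] by blast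
  moreover have "entry (reverse_complement \<pi>) (Suc n - i) + entry \<pi> i = Suc n"
    "entry (reverse_complement \<pi>) (Suc n - j) + entry \<pi> j = Suc n"
    "entry (reverse_complement \<pi>) (Suc n - k) + entry \<pi> k = Suc n"
    using p entry_add_reverse_complement[OF \<pi>] by simp_all
  ultimately show ?thesis
    unfolding contains_213[OF reverse_complement_in_perms[OF \<pi>]]
    by - (rule exI[of _ "Suc n - k"], rule exI[of _ "Suc n - j"], rule exI[of _ "Suc n - i"], linarith)
qed

lemma contains_132_reverse_complement:
  assumes \<pi>: "\<pi> \<in> perms n" and c: "contains_pattern \<pi> [2,1,3]"
  shows "contains_pattern (reverse_complement \<pi>) [1,3,2]"
proof -
  from c obtain i j k where p: "1 \<le> i" "i < j" "j < k" "k \<le> n"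
    "entry \<pi> j < entry \<pi> i" "entry \<pi> i < entry \<pi> k" unfolding contains_213[OF \<pi>] by blast
  moreover have "entry (reverse_complement \<pi>) (Suc n - i) + entry \<pi> i = Suc n"
    "entry (reverse_complement \<pi>) (Suc n - j) + entry \<pi> j = Suc n"
    "entry (reverse_complement \<pi>) (Suc n - k) + entry \<pi> k = Suc n"
    using p entry_add_reverse_complement[OF \<pi>] by simp_all
  ultimately show ?thesis
    unfolding contains_132[OF reverse_complement_in_perms[OF \<pi>]]
    by - (rule exI[of _ "Suc n - k"], rule exI[of _ "Suc n - j"], rule exI[of _ "Suc n - i"], linarith)
qed

text \<open>
  An injective self-map of a finite set is onto. Prefixes counted by \<open>comp_stat\<close> are therefore mapped onto
  their index range; this is what makes the count symmetric under inversion and reverse complement.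
\<close>

lemma prefix_image:
  assumes \<pi>: "\<pi> \<in> perms n" and i: "i \<le> n" and closed: "\<forall>j\<in>{1..i}. entry \<pi> j \<le> i"
  shows "entry \<pi> ` {1..i} = {1..i}"
proof (rule endo_inj_surj)
  show "entry \<pi> ` {1..i} \<subseteq> {1..i}"
    using closed entry_mem[OF \<pi>] i by fastforce
  show "inj_on (entry \<pi>) {1..i}"
    using i by (intro inj_on_subset[OF inj_on_entry[OF \<pi>]]) auto
qed simp

text \<open>
  If the first \<open>i\<close> entries are \<open>1, \<dots>, i\<close> in some order, then the last \<open>n - i\<close> are all larger than \<open>i\<close>; reversal and
  complementation turn these into an initial segment.
\<close>

lemma prefix_closed_reverse_complement:
  assumes \<pi>: "\<pi> \<in> perms n" and i: "i \<le> n" and closed: "\<forall>j\<in>{1..i}. entry \<pi> j \<le> i"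
  shows "\<forall>j\<in>{1..n - i}. entry (reverse_complement \<pi>) j \<le> n - i"
proof
  fix j assume j: "j \<in> {1..n - i}"
  have "i < entry \<pi> (Suc n - j)"
  proof (rule ccontr)
    assume "\<not> ?thesis"
    moreover have mem: "Suc n - j \<in> {1..n}" using j by auto
    ultimately have "entry \<pi> (Suc n - j) \<in> entry \<pi> ` {1..i}"
      unfolding prefix_image[OF assms] using entry_mem[OF \<pi>, of "Suc n - j"] by simp
    then obtain l where "l \<in> {1..i}" "entry \<pi> (Suc n - j) = entry \<pi> l" by blast
    then show False using entry_eq_iff[OF \<pi> mem, of l] j i by auto
  qed
  then show "entry (reverse_complement \<pi>) j \<le> n - i"
    using j i by (subst entry_reverse_complement[OF \<pi>]) auto
qed

text \<open>
  The reflection \<open>i \<mapsto> n - i\<close> sends the index \<open>n\<close>, which always counts, to \<open>0\<close>. Admitting \<open>0\<close> as an index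
  makes the set of counted indices invariant under it.
\<close>

lemma comp_stat_alt:
  assumes \<pi>: "\<pi> \<in> perms n"
  shows "comp_stat \<pi> = card {i \<in> {0..n}. \<forall>j\<in>{1..i}. entry \<pi> j \<le> i} - 1"
proof -
  have "{i \<in> {0..n}. \<forall>j\<in>{1..i}. entry \<pi> j \<le> i} =
      insert 0 {i \<in> {1..n}. \<forall>j\<in>{1..i}. entry \<pi> j \<le> i}" by force
  then have "card {i \<in> {0..n}. \<forall>j\<in>{1..i}. entry \<pi> j \<le> i} =
      Suc (card {i \<in> {1..n}. \<forall>j\<in>{1..i}. entry \<pi> j \<le> i})"
    by (simp only: card_insert_disjoint) (subst card_insert_disjoint, auto)
  then show ?thesis unfolding comp_stat_def length_perms[OF \<pi>] by simp
qed

lemma comp_stat_reverse_complement: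
  assumes \<pi>: "\<pi> \<in> perms n"
  shows "comp_stat (reverse_complement \<pi>) = comp_stat \<pi>"
proof -
  let ?C = "\<lambda>\<pi>. {i \<in> {0..n}. \<forall>j\<in>{1..i}. entry \<pi> j \<le> i}"
  have maps: "n - i \<in> ?C (reverse_complement \<rho>)" if "\<rho> \<in> perms n" "i \<in> ?C \<rho>" for \<rho> i
    using prefix_closed_reverse_complement[OF that(1), of i] that(2) by simp
  have "bij_betw (\<lambda>i. n - i) (?C \<pi>) (?C (reverse_complement \<pi>))"
  proof (rule bij_betw_byWitness[where f' = "\<lambda>i. n - i"])
    show "(\<lambda>i. n - i) ` ?C \<pi> \<subseteq> ?C (reverse_complement \<pi>)"
      using maps[OF \<pi>] by blast
    show "(\<lambda>i. n - i) ` ?C (reverse_complement \<pi>) \<subseteq> ?C \<pi>"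
      using maps[OF reverse_complement_in_perms[OF \<pi>]]
      unfolding reverse_complement_reverse_complement[OF \<pi>] by blast
  qed auto
  then show ?thesis
    using comp_stat_alt[OF \<pi>] comp_stat_alt[OF reverse_complement_in_perms[OF \<pi>]]
    by (simp add: bij_betw_same_card)
qed

lemma comp_132_213: "st_Wilf_equivalent comp_stat [1,3,2] [2,1,3]"
  by (rule st_Wilf_equivalentI_involution[where h = reverse_complement])
    (fact reverse_complement_in_perms reverse_complement_reverse_complement
      contains_213_reverse_complement contains_132_reverse_complement
      comp_stat_reverse_complement)+

definition inverse_word :: "nat list \<Rightarrow> nat list" where
  "inverse_word \<pi> = word (length \<pi>) (inv_into {1..length \<pi>} (entry \<pi>))"

lemma inverse_word_in_perms: "\<pi> \<in> perms n \<Longrightarrow> inverse_word \<pi> \<in> perms n"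
  unfolding inverse_word_def
  by (simp only: length_perms) (intro word_in_perms bij_betw_inv_into bij_betw_entry)

lemma entry_inverse_word:
  assumes \<pi>: "\<pi> \<in> perms n" and i: "i \<in> {1..n}"
  shows "entry (inverse_word \<pi>) (entry \<pi> i) = i"
  using entry_mem[OF \<pi> i] inv_into_f_f[OF inj_on_entry[OF \<pi>] i]
  by (simp add: inverse_word_def length_perms[OF \<pi>])

lemma inverse_word_inverse_word:
  assumes \<pi>: "\<pi> \<in> perms n"
  shows "inverse_word (inverse_word \<pi>) = \<pi>"
proof (rule perms_eqI)
  fix i assume i: "i \<in> {1..n}"
  have "entry (inverse_word (inverse_word \<pi>)) (entry (inverse_word \<pi>) (entry \<pi> i)) = entry \<pi> i"
    by (rule entry_inverse_word[OF inverse_word_in_perms[OF \<pi>] entry_mem[OF \<pi> i]])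
  then show "entry (inverse_word (inverse_word \<pi>)) i = entry \<pi> i"
    by (simp only: entry_inverse_word[OF \<pi> i])
qed (use \<pi> inverse_word_in_perms in auto)

lemma contains_312_inverse_word:
  assumes \<pi>: "\<pi> \<in> perms n" and c: "contains_pattern \<pi> [2,3,1]"
  shows "contains_pattern (inverse_word \<pi>) [3,1,2]"
proof -
  from c obtain i j k where p: "1 \<le> i" "i < j" "j < k" "k \<le> n"
    "entry \<pi> k < entry \<pi> i" "entry \<pi> i < entry \<pi> j" unfolding contains_231[OF \<pi>] by blast
  then show ?thesis
    unfolding contains_312[OF inverse_word_in_perms[OF \<pi>]]
    using entry_mem[OF \<pi>, of k] entry_mem[OF \<pi>, of j]
    by - (rule exI[of _ "entry \<pi> k"], rule exI[of _ "entry \<pi> i"], rule exI[of _ "entry \<pi> j"],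
      (simp add: entry_inverse_word[OF \<pi>]))
qed

lemma contains_231_inverse_word:
  assumes \<pi>: "\<pi> \<in> perms n" and c: "contains_pattern \<pi> [3,1,2]"
  shows "contains_pattern (inverse_word \<pi>) [2,3,1]"
proof -
  from c obtain i j k where p: "1 \<le> i" "i < j" "j < k" "k \<le> n"
    "entry \<pi> j < entry \<pi> k" "entry \<pi> k < entry \<pi> i" unfolding contains_312[OF \<pi>] by blast
  then show ?thesis
    unfolding contains_231[OF inverse_word_in_perms[OF \<pi>]]
    using entry_mem[OF \<pi>, of i] entry_mem[OF \<pi>, of j]
    by - (rule exI[of _ "entry \<pi> j"], rule exI[of _ "entry \<pi> k"], rule exI[of _ "entry \<pi> i"],
      (simp add: entry_inverse_word[OF \<pi>]))
qed

lemma comp_stat_inverse_word: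
  assumes \<pi>: "\<pi> \<in> perms n"
  shows "comp_stat (inverse_word \<pi>) = comp_stat \<pi>"
proof -
  have closed: "\<forall>j\<in>{1..i}. entry (inverse_word \<rho>) j \<le> i"
    if \<rho>: "\<rho> \<in> perms n" and i: "i \<le> n" and c: "\<forall>j\<in>{1..i}. entry \<rho> j \<le> i" for \<rho> i
  proof
    fix j assume "j \<in> {1..i}"
    then have "j \<in> entry \<rho> ` {1..i}" by (simp only: prefix_image[OF \<rho> i c])
    then obtain l where l: "l \<in> {1..i}" "j = entry \<rho> l" by blast
    then show "entry (inverse_word \<rho>) j \<le> i" using i entry_inverse_word[OF \<rho>, of l] by simp
  qed
  have "(\<forall>j\<in>{1..i}. entry (inverse_word \<pi>) j \<le> i) \<longleftrightarrow> (\<forall>j\<in>{1..i}. entry \<pi> j \<le> i)" if "i \<le> n" for i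
    using closed[OF \<pi> that] closed[OF inverse_word_in_perms[OF \<pi>] that]
    unfolding inverse_word_inverse_word[OF \<pi>] by blast
  then show ?thesis
    unfolding comp_stat_def length_perms[OF \<pi>] length_perms[OF inverse_word_in_perms[OF \<pi>]]
    by (intro arg_cong[where f = card] Collect_cong) auto
qed

lemma comp_231_312: "st_Wilf_equivalent comp_stat [2,3,1] [3,1,2]"
  by (rule st_Wilf_equivalentI_involution[where h = inverse_word])
    (fact inverse_word_in_perms inverse_word_inverse_word
      contains_312_inverse_word contains_231_inverse_word comp_stat_inverse_word)+

section \<open>Separating the classes\<close>

lemma strict_mono_on_self_map:
  assumes mono: "strict_mono_on {1..k} j" and sub: "j ` {1..k} \<subseteq> {1..k::nat}" and "a \<in> {1..k}"
  shows "j a = a"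
proof -
  have lower: "a \<le> j a" if "1 \<le> a" "a \<le> k" for a
    using that
  proof (induction a rule: dec_induct)
    case base
    have "j 1 \<in> {1..k}" using sub base by (intro subsetD[OF sub imageI]) simp
    then show ?case by simp
  next
    case (step a)
    have "j a < j (Suc a)" using step.hyps step.prems by (intro strict_mono_onD[OF mono]) auto
    with step show ?case by simp
  qed
  have upper: "j a \<le> a" if "1 \<le> a" "a \<le> k" for a
    using that(2,1)
  proof (induction a rule: inc_induct)
    case base
    have "j k \<in> {1..k}" using sub base by (intro subsetD[OF sub imageI]) simp
    then show ?case by simp
  next
    case (step a)
    have "j a < j (Suc a)" using step.hyps step.prems by (intro strict_mono_onD[OF mono]) auto
    with step show ?case by simp
  qed
  show ?thesis using lower[of a] upper[of a] assms(3) by simp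
qed

text \<open>
  An occurrence uses all \<open>k\<close> positions, in order, so it compares the two words entry by entry.
\<close>

lemma contains_pattern_self_iff:
  assumes \<sigma>: "\<sigma> \<in> perms k" and \<pi>: "\<pi> \<in> perms k"
  shows "contains_pattern \<pi> \<sigma> \<longleftrightarrow> \<pi> = \<sigma>"
proof
  assume "contains_pattern \<pi> \<sigma>"
  then obtain j where mono: "strict_mono_on {1..k} j" and sub: "j ` {1..k} \<subseteq> {1..k}"
    and less: "\<forall>a b. 1 \<le> a \<and> a < b \<and> b \<le> k \<longrightarrow>
      (entry \<pi> (j a) < entry \<pi> (j b) \<longleftrightarrow> entry \<sigma> a < entry \<sigma> b)"
    unfolding contains_pattern_def length_perms[OF \<sigma>] length_perms[OF \<pi>]
    by (elim exE conjE)
  show "\<pi> = \<sigma>"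
  proof (rule perms_eqI_order[OF \<pi> \<sigma>])
    fix x y assume "x \<in> {1..k}" "y \<in> {1..k}" "x < y"
    moreover from this have "j x = x" "j y = y" by (simp_all add: strict_mono_on_self_map[OF mono sub])
    ultimately show "entry \<pi> x < entry \<pi> y \<longleftrightarrow> entry \<sigma> x < entry \<sigma> y"
      using less[rule_format, of x y] by simp
  qed
next
  assume "\<pi> = \<sigma>"
  then show "contains_pattern \<pi> \<sigma>"
    unfolding contains_pattern_def by (intro exI[of _ id]) (simp add: strict_mono_on_def)
qed

text \<open>
  Among the permutations of size \<open>k\<close>, avoiding a pattern of size \<open>k\<close> only removes the pattern itself. The
  number of avoiders with a prescribed value therefore drops by one precisely at the value of the pattern,
  and that value can be read off from the distribution.
\<close>

lemma st_Wilf_equivalent_imp_st_eq: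
  assumes \<sigma>: "\<sigma> \<in> perms k" and \<tau>: "\<tau> \<in> perms k" and k: "1 \<le> k"
    and eq: "st_Wilf_equivalent st \<sigma> \<tau>"
  shows "st \<sigma> = st \<tau>"
proof (rule ccontr)
  assume ne: "st \<sigma> \<noteq> st \<tau>"
  let ?F = "{\<pi> \<in> perms k. st \<pi> = st \<sigma>}"
  have "{\<pi> \<in> avoiders k \<sigma>. st \<pi> = st \<sigma>} = ?F - {\<sigma>}"
    by (auto simp: avoiders_def contains_pattern_self_iff[OF \<sigma>])
  moreover have "{\<pi> \<in> avoiders k \<tau>. st \<pi> = st \<sigma>} = ?F"
    using ne by (auto simp: avoiders_def contains_pattern_self_iff[OF \<tau>])
  moreover have "card (?F - {\<sigma>}) < card ?F"
    using finite_perms \<sigma> by (intro card_Diff1_less) auto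
  moreover have "card {\<pi> \<in> avoiders k \<sigma>. st \<pi> = st \<sigma>} = card {\<pi> \<in> avoiders k \<tau>. st \<pi> = st \<sigma>}"
    using eq k unfolding st_Wilf_equivalent_def by blast
  ultimately show False by simp
qed

lemma perms_3: "perms 3 = {[1,2,3], [1,3,2], [2,1,3], [2,3,1], [3,1,2], [3,2,1]}"
proof -
  have "{1..3::nat} = {1, 2, 3}" by auto
  then show ?thesis
    unfolding perms_def
    by (subst permutations_of_set_nonempty)
      (simp_all add: insert_Diff_if permutations_of_set_doubleton insert_commute del: One_nat_def)
qed

lemma iar_three:
  "iar [x, y, z] = (if x > y then 1 else if y > z then 2 else 3)"
proof -
  have D: "i \<in> {1..length [x, y, z] - 1} \<and> entry [x, y, z] i > entry [x, y, z] (i + 1) \<longleftrightarrow>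
      i = 1 \<and> x > y \<or> i = 2 \<and> y > z" for i
    by (auto simp: entry_def nth_Cons split: nat.splits)
  have "(\<exists>i\<in>{1..length [x, y, z] - 1}. entry [x, y, z] i > entry [x, y, z] (i + 1)) \<longleftrightarrow> x > y \<or> y > z"
    unfolding Bex_def D by auto
  moreover have "(LEAST i::nat. i = 1 \<and> x > y \<or> i = 2 \<and> y > z) = (if x > y then 1 else 2)"
    if "x > y \<or> y > z" using that by (intro Least_equality) auto
  ultimately show ?thesis unfolding iar_def D by auto
qed

lemma comp_stat_three:
  "comp_stat [x, y, z] = of_bool (x \<le> 1) + of_bool (x \<le> 2 \<and> y \<le> 2) + of_bool (x \<le> 3 \<and> y \<le> 3 \<and> z \<le> 3)"
proof -
  have i: "{1..1} = {1::nat}" "{1..2} = {1, 2::nat}" "{1..3} = {1, 2, 3::nat}" by auto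
  have len: "{1..length [x, y, z]} = {1, 2, 3}" by auto
  have e: "entry [x, y, z] 1 = x" "entry [x, y, z] 2 = y" "entry [x, y, z] 3 = z"
    by (simp_all add: entry_def)
  have "comp_stat [x, y, z] = (\<Sum>i\<in>{1, 2, 3::nat}. of_bool (\<forall>j\<in>{1..i}. entry [x, y, z] j \<le> i))"
    unfolding comp_stat_def len by (subst sum_of_bool_eq) (auto simp: Int_def)
  also have "\<dots> = of_bool (x \<le> 1) + of_bool (x \<le> 2 \<and> y \<le> 2) + of_bool (x \<le> 3 \<and> y \<le> 3 \<and> z \<le> 3)"
    by (simp add: i e del: One_nat_def)
  finally show ?thesis .
qed

lemma quotient_st_Wilf_rel:
  assumes "\<And>\<sigma> \<tau>. \<sigma> \<in> perms k \<Longrightarrow> \<tau> \<in> perms k \<Longrightarrow> st_Wilf_equivalent st \<sigma> \<tau> \<longleftrightarrow> st \<sigma> = st \<tau>"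
  shows "perms k // st_Wilf_rel st k = (\<lambda>\<sigma>. {\<tau> \<in> perms k. st \<tau> = st \<sigma>}) ` perms k"
proof -
  have "st_Wilf_rel st k `` {\<sigma>} = {\<tau> \<in> perms k. st \<tau> = st \<sigma>}" if "\<sigma> \<in> perms k" for \<sigma>
    using assms that by (auto simp: st_Wilf_rel_def)
  then show ?thesis by (auto simp: quotient_def)
qed

lemma st_Wilf_equivalent_refl: "st_Wilf_equivalent st \<sigma> \<sigma>"
  by (simp add: st_Wilf_equivalent_def)

lemma st_Wilf_equivalent_sym: "st_Wilf_equivalent st \<sigma> \<tau> \<Longrightarrow> st_Wilf_equivalent st \<tau> \<sigma>"
  by (simp add: st_Wilf_equivalent_def)

lemma st_Wilf_equivalent_trans:
  "st_Wilf_equivalent st \<sigma> \<tau> \<Longrightarrow> st_Wilf_equivalent st \<tau> \<upsilon> \<Longrightarrow> st_Wilf_equivalent st \<sigma> \<upsilon>"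
  by (simp add: st_Wilf_equivalent_def)

lemma iar_Wilf_3_iff:
  assumes "\<sigma> \<in> perms 3" "\<tau> \<in> perms 3"
  shows "st_Wilf_equivalent iar \<sigma> \<tau> \<longleftrightarrow> iar \<sigma> = iar \<tau>"
proof
  note eqs = iar_132_231 iar_312_213 iar_312_321
    st_Wilf_equivalent_trans[OF st_Wilf_equivalent_sym[OF iar_312_213] iar_312_321]
  assume "iar \<sigma> = iar \<tau>"
  then show "st_Wilf_equivalent iar \<sigma> \<tau>"
    using assms eqs eqs[THEN st_Wilf_equivalent_sym] st_Wilf_equivalent_refl[of iar]
    unfolding perms_3 by (auto simp: iar_three simp del: One_nat_def)
qed (use st_Wilf_equivalent_imp_st_eq[OF assms] in simp)

lemma comp_Wilf_3_iff:
  assumes "\<sigma> \<in> perms 3" "\<tau> \<in> perms 3"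
  shows "st_Wilf_equivalent comp_stat \<sigma> \<tau> \<longleftrightarrow> comp_stat \<sigma> = comp_stat \<tau>"
proof
  note eqs = comp_132_213 comp_231_312 comp_312_321
    st_Wilf_equivalent_trans[OF comp_231_312 comp_312_321]
  assume "comp_stat \<sigma> = comp_stat \<tau>"
  then show "st_Wilf_equivalent comp_stat \<sigma> \<tau>"
    using assms eqs eqs[THEN st_Wilf_equivalent_sym] st_Wilf_equivalent_refl[of comp_stat]
    unfolding perms_3 by (auto simp: comp_stat_three simp del: One_nat_def)
qed (use st_Wilf_equivalent_imp_st_eq[OF assms] in simp)

theorem mainTheorem4:
  shows "perms 3 // st_Wilf_rel iar 3 =
           {{[2,1,3], [3,1,2], [3,2,1]}, {[1,3,2], [2,3,1]}, {[1,2,3]}} \<and>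
         perms 3 // st_Wilf_rel comp_stat 3 =
           {{[2,3,1], [3,1,2], [3,2,1]}, {[1,3,2], [2,1,3]}, {[1,2,3]}}"
proof
  have iar_fibres:
    "{\<tau> \<in> perms 3. iar \<tau> = 1} = {[2,1,3], [3,1,2], [3,2,1]}"
    "{\<tau> \<in> perms 3. iar \<tau> = 2} = {[1,3,2], [2,3,1]}"
    "{\<tau> \<in> perms 3. iar \<tau> = 3} = {[1,2,3]}"
    unfolding perms_3 by (auto simp: iar_three)
  have "perms 3 // st_Wilf_rel iar 3 = (\<lambda>v. {\<tau> \<in> perms 3. iar \<tau> = v}) ` iar ` perms 3"
    by (simp only: quotient_st_Wilf_rel[OF iar_Wilf_3_iff] image_image)
  also have "iar ` perms 3 = {1, 2, 3}" unfolding perms_3 by (auto simp: iar_three)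
  finally show "perms 3 // st_Wilf_rel iar 3 =
      {{[2,1,3], [3,1,2], [3,2,1]}, {[1,3,2], [2,3,1]}, {[1,2,3]}}"
    by (simp only: image_insert image_empty iar_fibres)
  have comp_fibres:
    "{\<tau> \<in> perms 3. comp_stat \<tau> = 1} = {[2,3,1], [3,1,2], [3,2,1]}"
    "{\<tau> \<in> perms 3. comp_stat \<tau> = 2} = {[1,3,2], [2,1,3]}"
    "{\<tau> \<in> perms 3. comp_stat \<tau> = 3} = {[1,2,3]}"
    unfolding perms_3 by (auto simp: comp_stat_three)
  have "perms 3 // st_Wilf_rel comp_stat 3 = (\<lambda>v. {\<tau> \<in> perms 3. comp_stat \<tau> = v}) ` comp_stat ` perms 3"
    by (simp only: quotient_st_Wilf_rel[OF comp_Wilf_3_iff] image_image)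
  also have "comp_stat ` perms 3 = {1, 2, 3}" unfolding perms_3 by (auto simp: comp_stat_three)
  finally show "perms 3 // st_Wilf_rel comp_stat 3 =
      {{[2,3,1], [3,1,2], [3,2,1]}, {[1,3,2], [2,1,3]}, {[1,2,3]}}"
    by (simp only: image_insert image_empty comp_fibres)
qed

end
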